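(* Let $q\in C[0,b]$ be complex valued, let $f$ be a solution of $f''=qf$ on $[0,b]$ with $f\neq0$ on $[0,b]$, $f(0)=1$, $h:=f'(0)$. Put $q_D=2\left(\frac{f'}f\right)^2-q$ and let $\mathbf{K}_D$ be the transmutation kernel associated with the potential $q_D$ and the parameter $-h$ on $R_1=\{(x,t):0\le|t|\le x\le b\}$. Let the complex numbers $a_0,\ldots,a_N$ and $b_1,\ldots,b_N$ be such that $$\left|\frac h2+\frac14\int_0^xq(s)\,ds-\sum_{n=0}^Na_n\mathbf{c}_n(x)\right|<\varepsilon_1\qquad\text{and}\qquad\left|\frac14\int_0^xq(s)\,ds-\sum_{n=1}^Nb_n\mathbf{s}_n(x)\right|<\varepsilon_2$$ for any $x\in[0,b]$. Then the kernel $\mathbf{K}_D(x,t)$ is approximated by the function $$K_{D,N}(x,t)=-b_0v_0(x,t)-\sum_{n=1}^Nb_nv_{2n-1}(x,t)-\sum_{n=1}^Na_nv_{2n}(x,t),\qquad b_0:=a_0,$$ in such a way that for any $(x,t)\in R_1$ $$\bigl|\mathbf{K}_D(x,t)-K_{D,N}(x,t)\bigr|\le C\bigl(\varepsilon_1M_1+(\varepsilon_1+\varepsilon_2)(2M_1M_2b+M_1+1)\bigr),$$ where $$C=3I_0\big(b\sqrt M\big),\qquad M:=\max_{[0,b]}|q_D(x)|,\qquad M_1:=\max_{[0,b]}\left|\frac1{f(x)}\right|,\qquad M_2:=\max_{[0,b]}|f'(x)|,$$ and $I_0$ is the modified Bessel function of the first kind.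
   Context: Kernel: $\mathbf{K}_D(x,t)=\mathbf{H}_D\big(\frac{x+t}{2},\frac{x-t}{2}\big)$ on $R_1$, where $\mathbf{H}_D(u,v)$, $u,v\ge0$, $u+v\le b$, is the unique solution of $\frac{\partial^2\mathbf{H}_D(u,v)}{\partial u\,\partial v}=q_D(u+v)\mathbf{H}_D(u,v)$, $\mathbf{H}_D(u,0)=-\frac h2+\frac12\int_0^u q_D(s)\,ds$, $\mathbf{H}_D(0,v)=-\frac h2$ (equivalently $\mathbf{H}_D(u,v)=-\frac h2+\frac12\int_0^u q_D(s)\,ds+\int_0^u\int_0^v q_D(\alpha+\beta)\mathbf{H}_D(\alpha,\beta)\,d\beta\,d\alpha$). It is the kernel of the transmutation operator $\mathbf{T}_{1/f}u(x)=u(x)+\int_{-x}^x\mathbf{K}_D(x,t)u(t)\,dt$ for the Darboux-associated equation $-u''+q_D(x)u=\omega^2u$, with $\mathbf{T}_{1/f}[1]=1/f$; note $1/f$ solves $v''=q_Dv$ with $(1/f)(0)=1$, $(1/f)'(0)=-h$. Recursive integrals on $[0,b]$: $X^{(0)}\equiv\widetilde X^{(0)}\equiv1$, $X^{(n)}(x)=n\int_0^x X^{(n-1)}(s)\left(f^2(s)\right)^{(-1)^n}ds$, $\widetilde X^{(n)}(x)=n\int_0^x \widetilde X^{(n-1)}(s)\left(f^2(s)\right)^{(-1)^{n-1}}ds$ for $n\ge1$. Then $\varphi_k=fX^{(k)}$ for $k$ odd, $\varphi_k=f\widetilde X^{(k)}$ for $k$ even; $\psi_k=\widetilde X^{(k)}/f$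 for $k$ odd, $\psi_k=X^{(k)}/f$ for $k$ even. Functions $\mathbf{c}_0=f$ and, for $m\ge1$, $\mathbf{c}_m(x)=\sum_{\text{even }k=0}^m\binom mk x^k\varphi_{m-k}(x)$, $\mathbf{s}_m(x)=\sum_{\text{odd }k=1}^m\binom mk x^k\varphi_{m-k}(x)$. Generalized wave polynomials for $\mathbf{T}_{1/f}$: $v_0(x,t)=\psi_0(x)$ and, for $m\ge1$, $v_{2m-1}(x,t)=\sum_{\text{even }k=0}^m\binom mk\psi_{m-k}(x)t^k$, $v_{2m}(x,t)=\sum_{\text{odd }k=1}^m\binom mk\psi_{m-k}(x)t^k$. *)

theory Defs
  imports "HOL-Analysis.Analysis"
begin

definition goursat_triangle :: "real \<Rightarrow> (real \<times> real) set" where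
  "goursat_triangle b = {(u, v). 0 \<le> u \<and> 0 \<le> v \<and> u + v \<le> b}"

text \<open>
  Classical solutions of the Goursat problem
  \<open>\<partial>\<^sup>2H/(\<partial>u \<partial>v) = q(u+v) H\<close> with potential \<open>q\<close> and parameter \<open>h\<close>.
  The witness \<open>Hv\<close> is the partial derivative of \<open>H\<close> in \<open>v\<close>; derivatives are one-sided on the
  boundary of the triangle.  For continuous \<open>q\<close> and \<open>b > 0\<close> the solution exists and its values
  on the triangle are unique; values outside the triangle are irrelevant.
\<close>
definition goursat_solution ::
    "real \<Rightarrow> (real \<Rightarrow> complex) \<Rightarrow> complex \<Rightarrow> (real \<Rightarrow> real \<Rightarrow> complex) \<Rightarrow> bool" where
  "goursat_solution b q h H \<longleftrightarrow>
     continuous_on (goursat_triangle b) (\<lambda>(u, v). H u v) \<and>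
     (\<exists>Hv. \<forall>(u, v) \<in> goursat_triangle b.
        ((\<lambda>y. H u y) has_vector_derivative Hv u v) (at v within {0..b - u}) \<and>
        ((\<lambda>y. Hv y v) has_vector_derivative q (u + v) * H u v) (at u within {0..b - v})) \<and>
     (\<forall>u\<in>{0..b}. H u 0 = h / 2 + 1 / 2 * integral {0..u} q) \<and>
     (\<forall>v\<in>{0..b}. H 0 v = h / 2)"

definition region_R1 :: "real \<Rightarrow> (real \<times> real) set" where
  "region_R1 b = {(x, t). 0 \<le> \<bar>t\<bar> \<and> \<bar>t\<bar> \<le> x \<and> x \<le> b}"

definition is_transmutation_kernel ::
    "real \<Rightarrow> (real \<Rightarrow> complex) \<Rightarrow> complex \<Rightarrow> (real \<Rightarrow> real \<Rightarrow> complex) \<Rightarrow> bool" where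
  "is_transmutation_kernel b q h K \<longleftrightarrow>
     (\<exists>H. goursat_solution b q h H \<and>
          (\<forall>(x, t) \<in> region_R1 b. K x t = H ((x + t) / 2) ((x - t) / 2)))"

text \<open>The argument \<open>f'\<close> stands for the derivative of \<open>f\<close>.\<close>
definition darboux_potential ::
    "(real \<Rightarrow> complex) \<Rightarrow> (real \<Rightarrow> complex) \<Rightarrow> (real \<Rightarrow> complex) \<Rightarrow> real \<Rightarrow> complex" where
  "darboux_potential q f f' x = 2 * (f' x / f x)\<^sup>2 - q x"

primrec X_int :: "(real \<Rightarrow> complex) \<Rightarrow> nat \<Rightarrow> real \<Rightarrow> complex" where
  "X_int f 0 = (\<lambda>x. 1)"
| "X_int f (Suc n) = (\<lambda>x. of_nat (Suc n) *
      integral {0..x} (\<lambda>s. X_int f n s * ((f s)\<^sup>2) powi ((- 1) ^ Suc n)))"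

primrec Xt_int :: "(real \<Rightarrow> complex) \<Rightarrow> nat \<Rightarrow> real \<Rightarrow> complex" where
  "Xt_int f 0 = (\<lambda>x. 1)"
| "Xt_int f (Suc n) = (\<lambda>x. of_nat (Suc n) *
      integral {0..x} (\<lambda>s. Xt_int f n s * ((f s)\<^sup>2) powi ((- 1) ^ n)))"

definition phi :: "(real \<Rightarrow> complex) \<Rightarrow> nat \<Rightarrow> real \<Rightarrow> complex" where
  "phi f k x = (if odd k then f x * X_int f k x else f x * Xt_int f k x)"

definition psi :: "(real \<Rightarrow> complex) \<Rightarrow> nat \<Rightarrow> real \<Rightarrow> complex" where
  "psi f k x = (if odd k then Xt_int f k x / f x else X_int f k x / f x)"

definition c_fun :: "(real \<Rightarrow> complex) \<Rightarrow> nat \<Rightarrow> real \<Rightarrow> complex" where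
  "c_fun f m x = (if m = 0 then f x
     else (\<Sum>k | even k \<and> k \<le> m. of_nat (m choose k) * of_real x ^ k * phi f (m - k) x))"

definition s_fun :: "(real \<Rightarrow> complex) \<Rightarrow> nat \<Rightarrow> real \<Rightarrow> complex" where
  "s_fun f m x =
     (\<Sum>k | odd k \<and> k \<le> m. of_nat (m choose k) * of_real x ^ k * phi f (m - k) x)"

text \<open>
  A positive index is \<open>2m - 1\<close> or \<open>2m\<close> with \<open>m \<ge> 1\<close>; in both cases \<open>m = (n + 1) div 2\<close>.
\<close>
definition wave_poly :: "(real \<Rightarrow> complex) \<Rightarrow> nat \<Rightarrow> real \<Rightarrow> real \<Rightarrow> complex" where
  "wave_poly f n x t = (let m = (n + 1) div 2 in
     if n = 0 then psi f 0 x
     else if odd n then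
       (\<Sum>k | even k \<and> k \<le> m. of_nat (m choose k) * psi f (m - k) x * of_real t ^ k)
     else
       (\<Sum>k | odd k \<and> k \<le> m. of_nat (m choose k) * psi f (m - k) x * of_real t ^ k))"

text \<open>
  The coefficients \<open>b\<^sub>1, \<dots>, b\<^sub>N\<close> are the values \<open>\<beta> 1, \<dots>, \<beta> N\<close>;
  the coefficient \<open>b\<^sub>0\<close> is by convention \<open>a 0\<close>.
\<close>
definition approx_kernel ::
    "(real \<Rightarrow> complex) \<Rightarrow> nat \<Rightarrow> (nat \<Rightarrow> complex) \<Rightarrow> (nat \<Rightarrow> complex) \<Rightarrow> real \<Rightarrow> real \<Rightarrow> complex" where
  "approx_kernel f N a \<beta> x t =
     - a 0 * wave_poly f 0 x t
     - (\<Sum>n=1..N. \<beta> n * wave_poly f (2 * n - 1) x t)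
     - (\<Sum>n=1..N. a n * wave_poly f (2 * n) x t)"

definition bessel_I0 :: "real \<Rightarrow> real" where
  "bessel_I0 z = (\<Sum>k. (z / 2) ^ (2 * k) / (fact k)\<^sup>2)"

end

theory Submission
  imports Defs
begin

text \<open>
  In the characteristic coordinates \<open>u = (x + t) / 2\<close>, \<open>v = (x - t) / 2\<close> both the kernel and the
  approximant solve \<open>\<partial>\<^sup>2W / \<partial>u \<partial>v = q\<^sub>D(u + v) W\<close>, hence so does their difference \<open>W\<close>, and it
  suffices to bound \<open>W\<close> on the two characteristics \<open>v = 0\<close> and \<open>u = 0\<close> and to propagate that bound
  into the triangle.

  The propagation is a Gronwall argument: integrating the equation twice gives
  \<open>\<bar>W(u, v)\<bar> \<le> B + M \<integral>\<integral> \<bar>W\<bar>\<close>, where \<open>B\<close> bounds \<open>\<bar>W(u, 0) + W(0, v) - W(0, 0)\<bar>\<close>, and iterating this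
  inequality produces the series \<open>B (\<Sum>k. (M u v)\<^sup>k / (k!)\<^sup>2)\<close>; as \<open>u v \<le> b\<^sup>2 / 4\<close> it is at most
  \<open>B\<close> times the Bessel value \<open>I\<^sub>0(b \<surd>M)\<close> (lemma \<open>goursat_bessel_bound\<close>).

  The boundary bound rests on the Darboux relation \<open>\<phi>\<^sub>k' = (f'/f) \<phi>\<^sub>k + k \<psi>\<^bsub>k-1\<^esub>\<close> and
  \<open>\<psi>\<^sub>k' = -(f'/f) \<psi>\<^sub>k + k \<phi>\<^bsub>k-1\<^esub>\<close>.  It shows first that the generalized wave polynomials solve the
  hyperbolic equation, and second that on the diagonal \<open>t = x\<close> the sums over \<open>\<phi>\<close> and over \<open>\<psi>\<close> of
  opposite parity are linked by the linear operator \<open>A g = g - (2/f) \<integral>\<^sub>0\<^sup>x f' g\<close>.  For \<open>m \<ge> 1\<close> the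
  functions \<open>A s\<^sub>m\<close> and \<open>A c\<^sub>m\<close> are the traces of \<open>v\<^bsub>2m-1\<^esub>\<close> and \<open>v\<^bsub>2m\<^esub>\<close>, \<open>A f = 1/f = v\<^sub>0\<close>, and the
  characteristic data of the kernel are values of \<open>A\<close> as well:
  \<open>-A (h/2 + (1/2) \<integral>q) = K\<^sub>D(x, x)\<close> and \<open>A 1 = 2/f - 1\<close>.  So with \<open>e\<^sub>1\<close>, \<open>e\<^sub>2\<close> the two approximation
  errors in the hypotheses, \<open>W = -A (e\<^sub>1 + e\<^sub>2)\<close> on \<open>t = x\<close> and
  \<open>W = -A (e\<^sub>2 - e\<^sub>1) - 2 e\<^sub>1(0) / f\<close> on \<open>t = -x\<close>; the last term comes from the convention
  \<open>b\<^sub>0 = a\<^sub>0\<close>.  Finally \<open>A\<close> has norm at most \<open>1 + 2 M\<^sub>1 M\<^sub>2 b\<close>.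
\<close>

section \<open>Growth of solutions of the Goursat problem\<close>

lemma norm_diff_le_integral_of_deriv_bound:
  fixes F F' :: "real \<Rightarrow> complex"
  assumes "0 \<le> r"
    and "\<And>s. s \<in> {0..r} \<Longrightarrow> (F has_vector_derivative F' s) (at s within {0..r})"
    and "\<And>s. s \<in> {0..r} \<Longrightarrow> norm (F' s) \<le> p s"
    and "(p has_integral I) {0..r}"
  shows "norm (F r - F 0) \<le> I"
proof -
  have "(F' has_integral (F r - F 0)) {0..r}"
    by (rule fundamental_theorem_of_calculus) (use assms in auto)
  then show ?thesis
    using integral_norm_bound_integral[of F' "{0..r}" p] assms(3,4)
    by (metis has_integral_integrable integral_unique)
qed

lemma power_sum_has_integral:
  fixes c :: "nat \<Rightarrow> real"
  assumes "0 \<le> r"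
  shows "((\<lambda>s. \<Sum>k\<le>n. c k * s ^ k) has_integral (\<Sum>k\<le>n. c k * r ^ Suc k / real (Suc k))) {0..r}"
proof (rule has_integral_sum)
  fix k assume "k \<in> {..n}"
  have "((\<lambda>s. c k * s ^ k) has_integral
      (c k * r ^ Suc k / real (Suc k) - c k * 0 ^ Suc k / real (Suc k))) {0..r}"
    by (rule fundamental_theorem_of_calculus[OF assms],
        unfold has_real_derivative_iff_has_vector_derivative[symmetric])
      (auto intro!: derivative_eq_intros simp del: power_Suc of_nat_Suc)
  then show "((\<lambda>s. c k * s ^ k) has_integral (c k * r ^ Suc k / real (Suc k))) {0..r}"
    by simp
qed simp

lemma summable_power_over_fact_square:
  fixes z :: real
  assumes "0 \<le> z"
  shows "summable (\<lambda>k. z ^ k / (fact k)\<^sup>2)"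
proof (rule summable_comparison_test'[OF summable_exp[of z]])
  fix k :: nat
  have "z ^ k * fact k \<ge> z ^ k * 1"
    using assms by (intro mult_left_mono) auto
  then show "norm (z ^ k / (fact k)\<^sup>2) \<le> inverse (fact k) * z ^ k"
    using assms by (simp add: divide_simps power2_eq_square)
qed

lemma bessel_I0_as_power_series: "bessel_I0 z = (\<Sum>k. ((z / 2)\<^sup>2) ^ k / (fact k)\<^sup>2)"
  by (simp add: bessel_I0_def power_mult)

lemma bessel_I0_nonneg: "0 \<le> bessel_I0 z"
  unfolding bessel_I0_as_power_series
  by (intro suminf_nonneg summable_power_over_fact_square) simp_all

locale goursat_bound =
  fixes b :: real and Q :: "real \<Rightarrow> complex" and W Wv :: "real \<Rightarrow> real \<Rightarrow> complex" and M B :: real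
  assumes W_deriv: "\<And>u v. (u, v) \<in> goursat_triangle b \<Longrightarrow>
        ((\<lambda>y. W u y) has_vector_derivative Wv u v) (at v within {0..b - u})"
    and Wv_deriv: "\<And>u v. (u, v) \<in> goursat_triangle b \<Longrightarrow>
        ((\<lambda>y. Wv y v) has_vector_derivative Q (u + v) * W u v) (at u within {0..b - v})"
    and Q_bound: "\<And>x. x \<in> {0..b} \<Longrightarrow> cmod (Q x) \<le> M"
    and data_bound: "\<And>u v. (u, v) \<in> goursat_triangle b \<Longrightarrow>
        cmod (W u 0 + W 0 v - W 0 0) \<le> B"
begin

text \<open>
  One Picard iteration for majorants in \<open>u v\<close>: integrating \<open>(u v)\<^sup>k\<close> in both variables gives
  \<open>(u v)\<^bsup>k+1\<^esup> / (k + 1)\<^sup>2\<close>.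
\<close>

lemma majorant_step:
  assumes maj: "\<And>u v. (u, v) \<in> goursat_triangle b \<Longrightarrow> cmod (W u v) \<le> (\<Sum>k\<le>n. c k * (u * v) ^ k)"
    and uv: "(u, v) \<in> goursat_triangle b"
  shows "cmod (W u v) \<le> B + (\<Sum>k\<le>n. M * c k * (u * v) ^ Suc k / (real (Suc k))\<^sup>2)"
proof -
  have u: "0 \<le> u" and v: "0 \<le> v" and uvb: "u + v \<le> b"
    using uv by (auto simp: goursat_triangle_def)
  have M: "0 \<le> M"
    using Q_bound[of 0] u v uvb order_trans[OF norm_ge_zero[of "Q 0"]] by simp
  have inner: "cmod (Wv u y - Wv 0 y) \<le> (\<Sum>k\<le>n. (M * c k * u ^ Suc k / real (Suc k)) * y ^ k)"
    if y: "y \<in> {0..v}" for y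
  proof -
    have "cmod (Wv u y - Wv 0 y) \<le> (\<Sum>k\<le>n. (M * c k * y ^ k) * u ^ Suc k / real (Suc k))"
    proof (rule norm_diff_le_integral_of_deriv_bound[OF u _ _ power_sum_has_integral[OF u]])
      fix s assume s: "s \<in> {0..u}"
      have tri: "(s, y) \<in> goursat_triangle b"
        using s y u v uvb by (auto simp: goursat_triangle_def)
      show "((\<lambda>s. Wv s y) has_vector_derivative Q (s + y) * W s y) (at s within {0..u})"
        by (rule has_vector_derivative_within_subset[OF Wv_deriv[OF tri]])
          (use y uvb in auto)
      have "cmod (Q (s + y) * W s y) \<le> M * (\<Sum>k\<le>n. c k * (s * y) ^ k)"
        unfolding norm_mult
        by (rule mult_mono[OF Q_bound maj[OF tri] M norm_ge_zero])
          (use tri in \<open>auto simp: goursat_triangle_def\<close>)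
      also have "\<dots> = (\<Sum>k\<le>n. (M * c k * y ^ k) * s ^ k)"
        by (simp add: sum_distrib_left power_mult_distrib mult_ac)
      finally show "cmod (Q (s + y) * W s y) \<le> (\<Sum>k\<le>n. (M * c k * y ^ k) * s ^ k)" .
    qed
    also have "\<dots> = (\<Sum>k\<le>n. (M * c k * u ^ Suc k / real (Suc k)) * y ^ k)"
      by (intro sum.cong refl) (simp add: mult_ac)
    finally show ?thesis .
  qed
  have "cmod ((W u v - W 0 v) - (W u 0 - W 0 0))
      \<le> (\<Sum>k\<le>n. (M * c k * u ^ Suc k / real (Suc k)) * v ^ Suc k / real (Suc k))"
  proof (rule norm_diff_le_integral_of_deriv_bound[OF v _ inner power_sum_has_integral[OF v]])
    fix y assume y: "y \<in> {0..v}"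
    have 1: "((\<lambda>y. W u y) has_vector_derivative Wv u y) (at y within {0..v})"
      by (rule has_vector_derivative_within_subset[OF W_deriv])
        (use y u v uvb in \<open>auto simp: goursat_triangle_def\<close>)
    have 2: "((\<lambda>y. W 0 y) has_vector_derivative Wv 0 y) (at y within {0..v})"
      by (rule has_vector_derivative_within_subset[OF W_deriv])
        (use y u v uvb in \<open>auto simp: goursat_triangle_def\<close>)
    show "((\<lambda>y. W u y - W 0 y) has_vector_derivative Wv u y - Wv 0 y) (at y within {0..v})"
      by (rule has_vector_derivative_diff[OF 1 2])
  qed
  also have "\<dots> = (\<Sum>k\<le>n. M * c k * (u * v) ^ Suc k / (real (Suc k))\<^sup>2)"
    by (intro sum.cong refl) (simp add: power2_eq_square power_mult_distrib mult_ac)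
  finally have 1: "cmod ((W u v - W 0 v) - (W u 0 - W 0 0))
      \<le> (\<Sum>k\<le>n. M * c k * (u * v) ^ Suc k / (real (Suc k))\<^sup>2)" .
  have "W u v = (W u 0 + W 0 v - W 0 0) + ((W u v - W 0 v) - (W u 0 - W 0 0))"
    by simp
  then have "cmod (W u v) \<le> cmod (W u 0 + W 0 v - W 0 0) + cmod ((W u v - W 0 v) - (W u 0 - W 0 0))"
    by (metis norm_triangle_ineq)
  with 1 data_bound[OF uv] show ?thesis by linarith
qed

lemma majorant_iterate:
  assumes S: "\<And>u v. (u, v) \<in> goursat_triangle b \<Longrightarrow> cmod (W u v) \<le> S"
    and uv: "(u, v) \<in> goursat_triangle b"
  shows "cmod (W u v) \<le> (\<Sum>k\<le>n. (if k < n then B else S) * M ^ k / (fact k)\<^sup>2 * (u * v) ^ k)"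
  using uv
proof (induction n arbitrary: u v)
  case 0
  then show ?case using S by simp
next
  case (Suc n)
  have "cmod (W u v) \<le> B + (\<Sum>k\<le>n. M * ((if k < n then B else S) * M ^ k / (fact k)\<^sup>2)
      * (u * v) ^ Suc k / (real (Suc k))\<^sup>2)"
    by (rule majorant_step[OF Suc.IH Suc.prems])
  also have "\<dots> = (\<Sum>k\<le>Suc n. (if k < Suc n then B else S) * M ^ k / (fact k)\<^sup>2 * (u * v) ^ k)"
    unfolding sum.atMost_Suc_shift
    by (simp add: power_mult_distrib mult_ac del: of_nat_Suc)
  finally show ?case .
qed

text \<open>
  The a priori bound \<open>S\<close> only enters the iteration through the remainder \<open>S (M u v)\<^sup>n / (n!)\<^sup>2\<close>,
  which tends to zero.
\<close>

lemma goursat_bessel_bound: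
  assumes S: "\<And>u v. (u, v) \<in> goursat_triangle b \<Longrightarrow> cmod (W u v) \<le> S"
    and uv: "(u, v) \<in> goursat_triangle b"
  shows "cmod (W u v) \<le> B * bessel_I0 (b * sqrt M)"
proof -
  have u: "0 \<le> u" and v: "0 \<le> v" and uvb: "u + v \<le> b"
    using uv by (auto simp: goursat_triangle_def)
  have M: "0 \<le> M"
    using Q_bound[of 0] u v uvb order_trans[OF norm_ge_zero[of "Q 0"]] by simp
  have B: "0 \<le> B" using data_bound[OF uv] norm_ge_zero order_trans by blast
  define z where "z = M * (u * v)"
  have z: "0 \<le> z" using M u v by (simp add: z_def)
  have "u * v \<le> b\<^sup>2 / 4"
  proof -
    have "4 * (u * v) \<le> (u + v)\<^sup>2"
      using zero_le_power2[of "u - v"] by (simp add: power2_eq_square algebra_simps)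
    also have "\<dots> \<le> b\<^sup>2" using u v uvb by (intro power_mono) auto
    finally show ?thesis by simp
  qed
  then have zw: "z \<le> (b * sqrt M / 2)\<^sup>2"
    using M mult_left_mono[of "u * v" "b\<^sup>2 / 4" M]
    by (simp add: z_def power_mult_distrib power_divide mult_ac)
  have "(\<Sum>k. z ^ k / (fact k)\<^sup>2) \<le> bessel_I0 (b * sqrt M)"
    unfolding bessel_I0_as_power_series
    by (rule suminf_le) (use summable_power_over_fact_square z zw in \<open>auto intro!: divide_right_mono power_mono\<close>)
  moreover have "cmod (W u v) \<le> B * (\<Sum>k. z ^ k / (fact k)\<^sup>2)"
  proof (rule tendsto_lowerbound)
    show "((\<lambda>n. B * (\<Sum>k<n. z ^ k / (fact k)\<^sup>2) + S * (z ^ n / (fact n)\<^sup>2)) \<longlongrightarrow>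
        B * (\<Sum>k. z ^ k / (fact k)\<^sup>2)) sequentially"
      using tendsto_add[OF tendsto_mult_left[OF summable_LIMSEQ[OF summable_power_over_fact_square[OF z]], of B]
          tendsto_mult_left[OF summable_LIMSEQ_zero[OF summable_power_over_fact_square[OF z]], of S]]
      by simp
    have "cmod (W u v) \<le> B * (\<Sum>k<n. z ^ k / (fact k)\<^sup>2) + S * (z ^ n / (fact n)\<^sup>2)" for n
    proof -
      have "(\<Sum>k\<le>n. (if k < n then B else S) * M ^ k / (fact k)\<^sup>2 * (u * v) ^ k) =
          (\<Sum>k\<le>n. (if k < n then B else S) * (z ^ k / (fact k)\<^sup>2))"
        by (intro sum.cong refl) (simp add: z_def power_mult_distrib)
      also have "\<dots> = B * (\<Sum>k<n. z ^ k / (fact k)\<^sup>2) + S * (z ^ n / (fact n)\<^sup>2)"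
        by (simp add: lessThan_Suc_atMost[symmetric] sum_distrib_left)
      finally show ?thesis using majorant_iterate[OF S uv, of n] by simp
    qed
    then show "\<forall>\<^sub>F n in sequentially. cmod (W u v) \<le>
        B * (\<Sum>k<n. z ^ k / (fact k)\<^sup>2) + S * (z ^ n / (fact n)\<^sup>2)" by simp
  qed simp
  ultimately show ?thesis using B by (meson mult_left_mono order_trans)
qed

end

section \<open>Binomial wave sums\<close>

text \<open>
  The part of \<open>\<Sum>k. (m choose k) \<xi>\<^bsub>m-k\<^esub>(x) t\<^sup>k\<close> that is even or odd in \<open>t\<close>.  For \<open>\<xi>\<^sub>k = x\<^sup>k\<close> these
  are the wave polynomials \<open>((x + t)\<^sup>m \<plusminus> (x - t)\<^sup>m) / 2\<close>.  One function covers \<open>c\<^sub>m\<close> and \<open>s\<^sub>m\<close>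
  (\<open>\<xi> = \<phi>\<close>, \<open>t = x\<close>) and the generalized wave polynomials (\<open>\<xi> = \<psi>\<close>).
\<close>

definition wave_sum ::
    "(nat \<Rightarrow> real \<Rightarrow> complex) \<Rightarrow> bool \<Rightarrow> nat \<Rightarrow> real \<Rightarrow> real \<Rightarrow> complex" where
  "wave_sum \<xi> ev m x t =
     (\<Sum>k\<le>m. if even k = ev then of_nat (m choose k) * \<xi> (m - k) x * of_real t ^ k else 0)"

lemma wave_sum_minus:
  "wave_sum \<xi> ev m x (- t) = (if ev then wave_sum \<xi> ev m x t else - wave_sum \<xi> ev m x t)"
  unfolding wave_sum_def
  by (auto simp: sum_negf[symmetric] intro!: sum.cong)

lemma wave_sum_at_origin:
  assumes "\<xi> m 0 = 0"
  shows "wave_sum \<xi> ev m 0 0 = 0"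
  unfolding wave_sum_def
proof (intro sum.neutral ballI)
  fix k
  show "(if even k = ev then of_nat (m choose k) * \<xi> (m - k) 0 * of_real 0 ^ k else 0) = 0"
    using assms by (cases k) auto
qed

lemma wave_sum_lower_left:
  "(\<Sum>k\<le>m. if even k = ev then of_nat (m choose k) * (of_nat (m - k) * \<xi> (m - k - 1) x) * of_real t ^ k else 0)
     = of_nat m * wave_sum \<xi> ev (m - 1) x t"
proof (cases m)
  case (Suc n)
  have coeff: "of_nat (Suc n choose k) * (of_nat (Suc n - k) * z) * w =
      of_nat (Suc n) * (of_nat (n choose k) * z * w)" for k and z w :: complex
  proof -
    have "of_nat (Suc n - k) * of_nat (Suc n choose k) = of_nat (Suc n) * (of_nat (n choose k) :: complex)"
      using binomial_absorb_comp[of "Suc n" k] by (metis diff_Suc_1 of_nat_mult)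
    then show ?thesis by (metis mult.assoc mult.commute)
  qed
  have "(if even k = ev then of_nat (Suc n choose k) * (of_nat (Suc n - k) * \<xi> (Suc n - k - 1) x) * of_real t ^ k else 0)
      = of_nat (Suc n) * (if even k = ev then of_nat (n choose k) * \<xi> (n - k) x * of_real t ^ k else 0)"
    for k
  proof -
    have "Suc n - k - 1 = n - k" by simp
    then show ?thesis by (simp only: coeff if_distrib[of "\<lambda>z. _ * z"] mult_zero_right)
  qed
  then show ?thesis
    unfolding Suc wave_sum_def diff_Suc_1 sum_distrib_left by simp
qed (simp only: atMost_0, simp)

lemma wave_sum_lower_right:
  "(\<Sum>k\<le>m. if even k = ev then of_nat (m choose k) * \<xi> (m - k) x * (of_nat k * of_real t ^ (k - 1)) else 0)
     = of_nat m * wave_sum \<xi> (\<not> ev) (m - 1) x t"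
proof (cases m)
  case (Suc n)
  have coeff: "of_nat (Suc n choose Suc k) * z * (of_nat (Suc k) * w) =
      of_nat (Suc n) * (of_nat (n choose k) * z * w)" for k and z w :: complex
  proof -
    have "of_nat (Suc k) * of_nat (Suc n choose Suc k) = of_nat (Suc n) * (of_nat (n choose k) :: complex)"
      using Suc_times_binomial[of k n] by (metis of_nat_mult)
    then show ?thesis by (metis mult.assoc mult.commute)
  qed
  have "(if even (Suc k) = ev then of_nat (Suc n choose Suc k) * \<xi> (Suc n - Suc k) x *
        (of_nat (Suc k) * of_real t ^ (Suc k - 1)) else 0)
      = of_nat (Suc n) * (if even k = (\<not> ev) then of_nat (n choose k) * \<xi> (n - k) x * of_real t ^ k else 0)"
    for k
  proof -
    have "even (Suc k) = ev \<longleftrightarrow> even k = (\<not> ev)" by auto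
    then show ?thesis
      by (simp only: coeff diff_Suc_1 diff_Suc_Suc if_distrib[of "\<lambda>z. _ * z"] mult_zero_right)
  qed
  then show ?thesis
    unfolding Suc wave_sum_def diff_Suc_1 sum_distrib_left sum.atMost_Suc_shift by simp
qed (simp only: atMost_0, simp)

text \<open>
  Along a line \<open>x = y + c\<close>, \<open>t = \<tau> y + d\<close> the three relevant directions are \<open>\<tau> = 1\<close> and \<open>\<tau> = -1\<close>
  (differentiation in \<open>u\<close> and \<open>v\<close>) and the diagonal \<open>x = t = y\<close>.
\<close>

lemma wave_sum_deriv:
  assumes \<xi>: "\<And>k x. x \<in> S \<Longrightarrow>
      (\<xi> k has_vector_derivative (r x * \<xi> k x + of_nat k * \<eta> (k - 1) x)) (at x within S)"
    and T: "(\<lambda>y. y + c) ` T \<subseteq> S" and y: "y \<in> T"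
  shows "((\<lambda>y. wave_sum \<xi> ev m (y + c) (\<tau> * y + d)) has_vector_derivative
      (r (y + c) * wave_sum \<xi> ev m (y + c) (\<tau> * y + d)
       + of_nat m * wave_sum \<eta> ev (m - 1) (y + c) (\<tau> * y + d)
       + of_real \<tau> * (of_nat m * wave_sum \<xi> (\<not> ev) (m - 1) (y + c) (\<tau> * y + d)))) (at y within T)"
proof -
  let ?x = "y + c" and ?t = "\<tau> * y + d"
  have shift: "((\<lambda>y. \<xi> k (y + c)) has_vector_derivative (r ?x * \<xi> k ?x + of_nat k * \<eta> (k - 1) ?x)) (at y within T)" for k
  proof -
    have 1: "((\<lambda>y. y + c) has_vector_derivative 1) (at y within T)"
      by (auto intro!: derivative_eq_intros)
    have 2: "(\<xi> k has_vector_derivative (r ?x * \<xi> k ?x + of_nat k * \<eta> (k - 1) ?x)) (at (y + c) within (\<lambda>y. y + c) ` T)"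
      by (rule has_vector_derivative_within_subset[OF \<xi> T]) (use T y in auto)
    show ?thesis using vector_diff_chain_within[OF 1 2] by (simp add: o_def)
  qed
  have pow: "((\<lambda>y. of_real (\<tau> * y + d) ^ k :: complex) has_vector_derivative
      of_real \<tau> * (of_nat k * of_real ?t ^ (k - 1))) (at y within T)" for k
  proof -
    have "((\<lambda>z. (of_real \<tau> * z + of_real d :: complex) ^ k) has_field_derivative
        of_real \<tau> * (of_nat k * (of_real \<tau> * of_real y + of_real d) ^ (k - 1))) (at (of_real y))"
      by (auto intro!: derivative_eq_intros)
    from has_vector_derivative_real_field[OF this, of T] show ?thesis by simp
  qed
  have "((\<lambda>y. wave_sum \<xi> ev m (y + c) (\<tau> * y + d)) has_vector_derivative
      (\<Sum>k\<le>m. if even k = ev then of_nat (m choose k) * \<xi> (m - k) ?x * (of_real \<tau> * (of_nat k * of_real ?t ^ (k - 1)))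
         + of_nat (m choose k) * (r ?x * \<xi> (m - k) ?x + of_nat (m - k) * \<eta> (m - k - 1) ?x) * of_real ?t ^ k else 0))
      (at y within T)"
    unfolding wave_sum_def
  proof (rule has_vector_derivative_sum)
    fix k assume "k \<in> {..m}"
    show "((\<lambda>y. if even k = ev then of_nat (m choose k) * \<xi> (m - k) (y + c) * of_real (\<tau> * y + d) ^ k else 0)
        has_vector_derivative
        (if even k = ev then of_nat (m choose k) * \<xi> (m - k) ?x * (of_real \<tau> * (of_nat k * of_real ?t ^ (k - 1)))
         + of_nat (m choose k) * (r ?x * \<xi> (m - k) ?x + of_nat (m - k) * \<eta> (m - k - 1) ?x) * of_real ?t ^ k else 0))
        (at y within T)"
    proof (cases "even k = ev")
      case True
      show ?thesis
        using has_vector_derivative_mult[OF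
            has_vector_derivative_mult_right[OF shift[of "m - k"], of "of_nat (m choose k)"] pow[of k]] True
        by simp
    qed simp
  qed
  also have "(\<Sum>k\<le>m. if even k = ev then of_nat (m choose k) * \<xi> (m - k) ?x * (of_real \<tau> * (of_nat k * of_real ?t ^ (k - 1)))
         + of_nat (m choose k) * (r ?x * \<xi> (m - k) ?x + of_nat (m - k) * \<eta> (m - k - 1) ?x) * of_real ?t ^ k else 0)
     = r ?x * wave_sum \<xi> ev m ?x ?t
       + (\<Sum>k\<le>m. if even k = ev then of_nat (m choose k) * (of_nat (m - k) * \<eta> (m - k - 1) ?x) * of_real ?t ^ k else 0)
       + of_real \<tau> * (\<Sum>k\<le>m. if even k = ev then of_nat (m choose k) * \<xi> (m - k) ?x * (of_nat k * of_real ?t ^ (k - 1)) else 0)"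
    unfolding wave_sum_def sum_distrib_left sum.distrib[symmetric]
    by (intro sum.cong refl) (auto simp: algebra_simps)
  also note wave_sum_lower_left
  also note wave_sum_lower_right
  finally show ?thesis .
qed

section \<open>Formal powers of a non-vanishing solution\<close>

locale nonvanishing_solution =
  fixes b :: real and q f f' :: "real \<Rightarrow> complex"
  assumes b_pos: "0 < b"
    and q_cont: "continuous_on {0..b} q"
    and f_deriv: "\<And>x. x \<in> {0..b} \<Longrightarrow> (f has_vector_derivative f' x) (at x within {0..b})"
    and f'_deriv: "\<And>x. x \<in> {0..b} \<Longrightarrow> (f' has_vector_derivative q x * f x) (at x within {0..b})"
    and f_nz: "\<And>x. x \<in> {0..b} \<Longrightarrow> f x \<noteq> 0"
    and f0: "f 0 = 1"
begin

abbreviation "qD \<equiv> darboux_potential q f f'"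

lemma f_cont: "continuous_on {0..b} f"
  by (rule continuous_on_vector_derivative[OF f_deriv])

lemma f'_cont: "continuous_on {0..b} f'"
  by (rule continuous_on_vector_derivative[OF f'_deriv])

lemma qD_cont: "continuous_on {0..b} qD"
  unfolding darboux_potential_def
  using f_nz by (auto intro!: continuous_intros f_cont f'_cont q_cont)

lemma inverse_f_deriv:
  assumes "x \<in> {0..b}"
  shows "((\<lambda>x. inverse (f x)) has_vector_derivative - f' x / (f x)\<^sup>2) (at x within {0..b})"
proof -
  have "(inverse has_field_derivative - inverse (f x) * inverse (f x)) (at (f x) within f ` {0..b})"
    using f_nz[OF assms] by (auto intro!: derivative_eq_intros)
  from field_vector_diff_chain_within[OF f_deriv[OF assms] this]
  show ?thesis by (simp add: o_def divide_inverse power2_eq_square)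
qed

lemma log_deriv_deriv:
  assumes "x \<in> {0..b}"
  shows "((\<lambda>x. f' x / f x) has_vector_derivative q x - (f' x / f x)\<^sup>2) (at x within {0..b})"
  using has_vector_derivative_mult[OF f'_deriv[OF assms] inverse_f_deriv[OF assms]] f_nz[OF assms]
  by (simp add: divide_inverse[symmetric] power2_eq_square field_simps)

lemma weight_cont: "continuous_on {0..b} (\<lambda>s. (f s)\<^sup>2 powi ((- 1) ^ n))"
  using f_nz by (cases "even n") (auto intro!: continuous_intros f_cont)

lemma X_int_deriv:
  "x \<in> {0..b} \<Longrightarrow> (X_int f k has_vector_derivative
      of_nat k * (X_int f (k - 1) x * (f x)\<^sup>2 powi ((- 1) ^ k))) (at x within {0..b})"
proof (induction k arbitrary: x)
  case (Suc k)
  have "continuous_on {0..b} (X_int f k)"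
    by (rule continuous_on_vector_derivative[OF Suc.IH])
  then have "continuous_on {0..b} (\<lambda>s. X_int f k s * (f s)\<^sup>2 powi ((- 1) ^ Suc k))"
    by (intro continuous_on_mult weight_cont)
  from has_vector_derivative_mult_right[OF integral_has_vector_derivative[OF this Suc.prems],
      of "of_nat (Suc k)"]
  show ?case by (simp only: X_int.simps diff_Suc_1)
qed simp

lemma Xt_int_deriv:
  "x \<in> {0..b} \<Longrightarrow> (Xt_int f k has_vector_derivative
      of_nat k * (Xt_int f (k - 1) x * (f x)\<^sup>2 powi ((- 1) ^ (k - 1)))) (at x within {0..b})"
proof (induction k arbitrary: x)
  case (Suc k)
  have "continuous_on {0..b} (Xt_int f k)"
    by (rule continuous_on_vector_derivative[OF Suc.IH])
  then have "continuous_on {0..b} (\<lambda>s. Xt_int f k s * (f s)\<^sup>2 powi ((- 1) ^ k))"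
    by (intro continuous_on_mult weight_cont)
  from has_vector_derivative_mult_right[OF integral_has_vector_derivative[OF this Suc.prems],
      of "of_nat (Suc k)"]
  show ?case by (simp only: Xt_int.simps diff_Suc_1)
qed simp

text \<open>
  The first order operators \<open>d/dx - f'/f\<close> and \<open>d/dx + f'/f\<close> interchange the two families of formal
  powers up to the factor \<open>k\<close>; their products are the two Schroedinger operators with potentials
  \<open>q\<close> and \<open>q\<^sub>D\<close>.
\<close>

lemma phi_deriv:
  assumes x: "x \<in> {0..b}"
  shows "(phi f k has_vector_derivative
      (f' x / f x * phi f k x + of_nat k * psi f (k - 1) x)) (at x within {0..b})"
proof -
  have alg: "f x * (of_nat k * (X * inverse ((f x)\<^sup>2))) + f' x * Y
      = f' x / f x * (f x * Y) + of_nat k * (X / f x)" for X Y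
    using f_nz[OF x] by (simp add: field_simps power2_eq_square)
  show ?thesis
  proof (cases "odd k")
    case True
    have phi: "phi f k = (\<lambda>x. f x * X_int f k x)" using True by (auto simp: phi_def)
    have psi: "psi f (k - 1) x = X_int f (k - 1) x / f x" using True by (simp add: psi_def)
    have weight: "(f x)\<^sup>2 powi ((- 1) ^ k) = inverse ((f x)\<^sup>2)" using True by simp
    show ?thesis
      using has_vector_derivative_mult[OF f_deriv[OF x] X_int_deriv[OF x, of k]]
      unfolding phi psi weight alg .
  next
    case False
    have phi: "phi f k = (\<lambda>x. f x * Xt_int f k x)" using False by (auto simp: phi_def)
    have psi: "of_nat k * psi f (k - 1) x = of_nat k * (Xt_int f (k - 1) x / f x)"
      using False by (cases "k = 0") (simp_all only: psi_def, simp_all)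
    have weight: "of_nat k * (X * (f x)\<^sup>2 powi ((- 1) ^ (k - 1))) = of_nat k * (X * inverse ((f x)\<^sup>2))"
      for X
    proof (cases "k = 0")
      case nz: False
      have "(- 1 :: int) ^ (k - 1) = - 1" using False nz by simp
      then show ?thesis by (simp only: power_int_minus power_int_1_right)
    qed (simp only: of_nat_0 mult_zero_left)
    show ?thesis
      using has_vector_derivative_mult[OF f_deriv[OF x] Xt_int_deriv[OF x, of k]]
      unfolding phi psi weight alg .
  qed
qed

lemma psi_deriv:
  assumes x: "x \<in> {0..b}"
  shows "(psi f k has_vector_derivative
      (- (f' x / f x) * psi f k x + of_nat k * phi f (k - 1) x)) (at x within {0..b})"
proof -
  have alg: "inverse (f x) * (of_nat k * (X * (f x)\<^sup>2)) + - f' x / (f x)\<^sup>2 * Y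
      = - (f' x / f x) * (inverse (f x) * Y) + of_nat k * (f x * X)" for X Y
    using f_nz[OF x] by (simp add: field_simps power2_eq_square)
  show ?thesis
  proof (cases "odd k")
    case True
    have psi: "psi f k = (\<lambda>x. inverse (f x) * Xt_int f k x)"
      using True by (auto simp: psi_def divide_inverse)
    have phi: "phi f (k - 1) x = f x * Xt_int f (k - 1) x" using True by (simp add: phi_def)
    have weight: "(f x)\<^sup>2 powi ((- 1) ^ (k - 1)) = (f x)\<^sup>2" using True by simp
    show ?thesis
      using has_vector_derivative_mult[OF inverse_f_deriv[OF x] Xt_int_deriv[OF x, of k]]
      unfolding phi psi weight alg .
  next
    case False
    have psi: "psi f k = (\<lambda>x. inverse (f x) * X_int f k x)"
      using False by (auto simp: psi_def divide_inverse)
    have phi: "of_nat k * phi f (k - 1) x = of_nat k * (f x * X_int f (k - 1) x)"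
      using False by (cases "k = 0") (simp_all only: phi_def, simp_all)
    have weight: "(f x)\<^sup>2 powi ((- 1) ^ k) = (f x)\<^sup>2" using False by simp
    show ?thesis
      using has_vector_derivative_mult[OF inverse_f_deriv[OF x] X_int_deriv[OF x, of k]]
      unfolding phi psi weight alg .
  qed
qed

lemma psi_cont: "continuous_on {0..b} (psi f k)"
  by (rule continuous_on_vector_derivative[OF psi_deriv])

lemma phi_psi_at_0: "phi f (Suc k) 0 = 0" "psi f (Suc k) 0 = 0"
  by (simp_all add: phi_def psi_def)

lemmas phi_sum_deriv = wave_sum_deriv[where S = "{0..b}" and \<xi> = "phi f" and \<eta> = "psi f"
    and r = "\<lambda>x. f' x / f x", OF phi_deriv]

lemmas psi_sum_deriv = wave_sum_deriv[where S = "{0..b}" and \<xi> = "psi f" and \<eta> = "phi f"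
    and r = "\<lambda>x. - (f' x / f x)", OF psi_deriv]

section \<open>Generalized wave polynomials solve the hyperbolic equation\<close>

text \<open>The \<open>v\<close>-derivative of a sum over \<open>\<psi>\<close> at \<open>x = u + v\<close>, \<open>t = u - v\<close>.\<close>

definition psi_sum_dv :: "bool \<Rightarrow> nat \<Rightarrow> real \<Rightarrow> real \<Rightarrow> complex" where
  "psi_sum_dv ev m u v = - (f' (u + v) / f (u + v)) * wave_sum (psi f) ev m (u + v) (u - v)
     + of_nat m * wave_sum (phi f) ev (m - 1) (u + v) (u - v)
     - of_nat m * wave_sum (psi f) (\<not> ev) (m - 1) (u + v) (u - v)"

lemma psi_sum_deriv_v:
  assumes "(u, v) \<in> goursat_triangle b"
  shows "((\<lambda>y. wave_sum (psi f) ev m (u + y) (u - y)) has_vector_derivative psi_sum_dv ev m u v)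
      (at v within {0..b - u})"
proof -
  have "((\<lambda>y. wave_sum (psi f) ev m (y + u) (- 1 * y + u)) has_vector_derivative
      psi_sum_dv ev m u v) (at v within {0..b - u})"
    using psi_sum_deriv[where c = u and d = u and \<tau> = "- 1" and T = "{0..b - u}" and y = v
        and ev = ev and m = m] assms
    by (auto simp: psi_sum_dv_def goursat_triangle_def add.commute)
  then show ?thesis by (simp add: add.commute)
qed

text \<open>
  The terms with lower index cancel between the two directions, and
  \<open>-(f'/f)' + (f'/f)\<^sup>2 = 2 (f'/f)\<^sup>2 - q = q\<^sub>D\<close> is what remains.
\<close>

lemma psi_sum_deriv_uv:
  assumes tri: "(u, v) \<in> goursat_triangle b"
  shows "((\<lambda>y. psi_sum_dv ev m y v) has_vector_derivative
      qD (u + v) * wave_sum (psi f) ev m (u + v) (u - v)) (at u within {0..b - v})"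
proof -
  let ?T = "{0..b - v}"
  have T: "(\<lambda>y. y + v) ` ?T \<subseteq> {0..b}" and u: "u \<in> ?T"
    using tri by (auto simp: goursat_triangle_def)
  have x: "u + v \<in> {0..b}" using T u by auto
  have shift: "((\<lambda>y. y + v) has_vector_derivative 1) (at u within ?T)"
    by (auto intro!: derivative_eq_intros)
  have 0: "((\<lambda>y. f' (y + v) / f (y + v)) has_vector_derivative
      q (u + v) - (f' (u + v) / f (u + v))\<^sup>2) (at u within ?T)"
    using vector_diff_chain_within[OF shift has_vector_derivative_within_subset[OF log_deriv_deriv[OF x] T]]
    by (simp add: o_def)
  note 1 = psi_sum_deriv[where c = v and d = "- v" and \<tau> = 1 and ev = ev and m = m, OF _ T u, simplified]
  note 2 = phi_sum_deriv[where c = v and d = "- v" and \<tau> = 1 and ev = ev and m = "m - 1", OF _ T u, simplified]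
  note 3 = psi_sum_deriv[where c = v and d = "- v" and \<tau> = 1 and ev = "\<not> ev" and m = "m - 1", OF _ T u, simplified]
  show ?thesis
    unfolding psi_sum_dv_def One_nat_def
    by (rule has_vector_derivative_eq_rhs,
        rule has_vector_derivative_diff[OF has_vector_derivative_add[OF
            has_vector_derivative_mult[OF has_vector_derivative_minus[OF 0] 1]
            has_vector_derivative_mult_right[OF 2]] has_vector_derivative_mult_right[OF 3]])
      (simp add: darboux_potential_def power2_eq_square algebra_simps)
qed

lemma psi_sum_cont:
  "continuous_on (goursat_triangle b) (\<lambda>(u, v). wave_sum (psi f) ev m (u + v) (u - v))"
proof -
  have psi: "continuous_on (goursat_triangle b) (\<lambda>p. psi f k (fst p + snd p))" for k
    by (rule continuous_on_compose2[OF psi_cont])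
      (auto intro!: continuous_intros simp: goursat_triangle_def)
  have "continuous_on (goursat_triangle b)
      (\<lambda>p. wave_sum (psi f) ev m (fst p + snd p) (fst p - snd p))"
    unfolding wave_sum_def
  proof (rule continuous_on_sum)
    fix k assume "k \<in> {..m}"
    show "continuous_on (goursat_triangle b) (\<lambda>p. if even k = ev then
        of_nat (m choose k) * psi f (m - k) (fst p + snd p) * of_real (fst p - snd p) ^ k else 0)"
      by (cases "even k = ev") (simp_all, intro continuous_intros psi)
  qed
  then show ?thesis by (simp add: case_prod_unfold)
qed

section \<open>The Darboux transform of diagonal values\<close>

text \<open>
  The graph of \<open>A g = g - (2/f) \<integral>\<^sub>0\<^sup>x f' g\<close>, written as an integral relation so that linearity is
  that of the integral.
\<close>

definition darboux_pair :: "(real \<Rightarrow> complex) \<Rightarrow> (real \<Rightarrow> complex) \<Rightarrow> bool" where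
  "darboux_pair g G \<longleftrightarrow>
     (\<forall>x\<in>{0..b}. ((\<lambda>s. 2 * f' s * g s) has_integral f x * (g x - G x)) {0..x})"

lemma darboux_pairI:
  assumes "\<And>x. x \<in> {0..b} \<Longrightarrow>
      ((\<lambda>x. f x * (g x - G x)) has_vector_derivative 2 * f' x * g x) (at x within {0..b})"
    and "g 0 = G 0"
  shows "darboux_pair g G"
  unfolding darboux_pair_def
proof
  fix x assume x: "x \<in> {0..b}"
  have "((\<lambda>s. 2 * f' s * g s) has_integral f x * (g x - G x) - f 0 * (g 0 - G 0)) {0..x}"
    by (rule fundamental_theorem_of_calculus)
      (use x in \<open>auto intro!: has_vector_derivative_within_subset[OF assms(1)]\<close>)
  then show "((\<lambda>s. 2 * f' s * g s) has_integral f x * (g x - G x)) {0..x}"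
    using assms(2) by simp
qed

lemma darboux_pair_add:
  assumes "darboux_pair g G" and "darboux_pair k K"
  shows "darboux_pair (\<lambda>x. g x + k x) (\<lambda>x. G x + K x)"
  unfolding darboux_pair_def
proof
  fix x assume "x \<in> {0..b}"
  then have "((\<lambda>s. 2 * f' s * g s + 2 * f' s * k s) has_integral
      f x * (g x - G x) + f x * (k x - K x)) {0..x}"
    using assms by (intro has_integral_add) (auto simp: darboux_pair_def)
  then show "((\<lambda>s. 2 * f' s * (g s + k s)) has_integral f x * (g x + k x - (G x + K x))) {0..x}"
    by (simp add: algebra_simps)
qed

lemma darboux_pair_scale:
  assumes "darboux_pair g G"
  shows "darboux_pair (\<lambda>x. c * g x) (\<lambda>x. c * G x)"
  unfolding darboux_pair_def
proof
  fix x assume "x \<in> {0..b}"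
  then have "((\<lambda>s. c * (2 * f' s * g s)) has_integral c * (f x * (g x - G x))) {0..x}"
    using assms by (intro has_integral_mult_right) (auto simp: darboux_pair_def)
  then show "((\<lambda>s. 2 * f' s * (c * g s)) has_integral f x * (c * g x - c * G x)) {0..x}"
    by (simp add: algebra_simps)
qed

lemma darboux_pair_diff:
  assumes "darboux_pair g G" and "darboux_pair k K"
  shows "darboux_pair (\<lambda>x. g x - k x) (\<lambda>x. G x - K x)"
  using darboux_pair_add[OF assms(1) darboux_pair_scale[OF assms(2), of "- 1"]] by simp

lemma darboux_pair_sum:
  assumes "\<And>n. n \<in> I \<Longrightarrow> darboux_pair (g n) (G n)"
  shows "darboux_pair (\<lambda>x. \<Sum>n\<in>I. g n x) (\<lambda>x. \<Sum>n\<in>I. G n x)"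
  using assms
proof (induction I rule: infinite_finite_induct)
  case (insert n I)
  then show ?case by (simp add: darboux_pair_add)
qed (simp_all add: darboux_pair_def)

lemma darboux_pair_bound:
  assumes pair: "darboux_pair g G" and x: "x \<in> {0..b}"
    and g: "\<And>s. s \<in> {0..b} \<Longrightarrow> cmod (g s) \<le> \<epsilon>"
    and M1: "cmod (1 / f x) \<le> M1" and M2: "\<And>s. s \<in> {0..b} \<Longrightarrow> cmod (f' s) \<le> M2"
  shows "cmod (G x) \<le> \<epsilon> * (1 + 2 * M1 * M2 * b)"
proof -
  have \<epsilon>: "0 \<le> \<epsilon>" using g[OF x] norm_ge_zero order_trans by blast
  have M2': "0 \<le> M2" using M2[OF x] norm_ge_zero order_trans by blast
  have "cmod (f x * (g x - G x)) \<le> 2 * M2 * \<epsilon> * measure lborel (cbox 0 x)"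
  proof (rule has_integral_bound)
    show "((\<lambda>s. 2 * f' s * g s) has_integral f x * (g x - G x)) (cbox 0 x)"
      using pair x by (simp add: darboux_pair_def)
    fix s assume "s \<in> cbox 0 x"
    then have "s \<in> {0..b}" using x by auto
    then show "norm (2 * f' s * g s) \<le> 2 * M2 * \<epsilon>"
      using g M2 M2' by (simp add: norm_mult mult_mono)
  qed (use M2' \<epsilon> in simp)
  also have "\<dots> = 2 * M2 * \<epsilon> * x" using x by simp
  also have "\<dots> \<le> 2 * M2 * \<epsilon> * b"
    using x M2' \<epsilon> by (intro mult_left_mono) auto
  finally have 1: "cmod (f x * (g x - G x)) \<le> 2 * M2 * \<epsilon> * b" .
  have "cmod (g x - G x) = cmod (1 / f x) * cmod (f x * (g x - G x))"
    using f_nz[OF x] by (simp add: norm_mult norm_divide)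
  also have "\<dots> \<le> M1 * (2 * M2 * \<epsilon> * b)"
    by (rule mult_mono[OF M1 1]) (use M1 order_trans[OF norm_ge_zero M1] in auto)
  finally have "cmod (g x - G x) \<le> M1 * (2 * M2 * \<epsilon> * b)" .
  moreover have "cmod (G x) \<le> cmod (g x) + cmod (g x - G x)"
    by (metis norm_minus_commute norm_triangle_sub)
  ultimately show ?thesis using g[OF x] by (simp add: algebra_simps)
qed

lemma darboux_pair_f: "darboux_pair f (\<lambda>x. 1 / f x)"
proof (rule darboux_pairI)
  fix x assume x: "x \<in> {0..b}"
  have "((\<lambda>x. f x * f x - 1) has_vector_derivative 2 * f' x * f x) (at x within {0..b})"
    by (rule has_vector_derivative_eq_rhs,
        rule has_vector_derivative_diff[OF has_vector_derivative_mult[OF f_deriv[OF x] f_deriv[OF x]]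
          has_vector_derivative_const]) simp
  moreover have "f y * (f y - 1 / f y) = f y * f y - 1" if "y \<in> {0..b}" for y
    using f_nz[OF that] by (simp add: field_simps)
  ultimately show "((\<lambda>x. f x * (f x - 1 / f x)) has_vector_derivative 2 * f' x * f x) (at x within {0..b})"
    by (rule has_vector_derivative_transform[OF x, rotated]) auto
qed (simp add: f0)

lemma darboux_pair_1: "darboux_pair (\<lambda>x. 1) (\<lambda>x. 2 / f x - 1)"
proof (rule darboux_pairI)
  fix x assume x: "x \<in> {0..b}"
  have "((\<lambda>x. 2 * f x - 2) has_vector_derivative 2 * f' x * 1) (at x within {0..b})"
    by (rule has_vector_derivative_eq_rhs,
        rule has_vector_derivative_diff[OF has_vector_derivative_mult_right[OF f_deriv[OF x]]
          has_vector_derivative_const]) simp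
  moreover have "f y * (1 - (2 / f y - 1)) = 2 * f y - 2" if "y \<in> {0..b}" for y
    using f_nz[OF that] by (simp add: field_simps)
  ultimately show "((\<lambda>x. f x * (1 - (2 / f x - 1))) has_vector_derivative 2 * f' x * 1) (at x within {0..b})"
    by (rule has_vector_derivative_transform[OF x, rotated]) auto
qed (simp add: f0)

text \<open>This integrates \<open>q\<^sub>D = q - 2 (f'/f)'\<close>.\<close>

lemma integral_qD:
  assumes x: "x \<in> {0..b}"
  shows "integral {0..x} qD = integral {0..x} q - 2 * (f' x / f x) + 2 * f' 0"
proof -
  have sub: "{0..x} \<subseteq> {0..b}" using x by auto
  have "((\<lambda>s. q s - (f' s / f s)\<^sup>2) has_integral f' x / f x - f' 0 / f 0) {0..x}"
    by (rule fundamental_theorem_of_calculus)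
      (use x in \<open>auto intro!: has_vector_derivative_within_subset[OF log_deriv_deriv]\<close>)
  from has_integral_diff[OF integrable_integral[OF
        integrable_continuous_interval[OF continuous_on_subset[OF q_cont sub]]]
      has_integral_mult_right[OF this, of 2]]
  have "(qD has_integral integral {0..x} q - 2 * (f' x / f x - f' 0 / f 0)) {0..x}"
    by (rule has_integral_eq[rotated]) (simp add: darboux_potential_def)
  then show ?thesis by (simp add: integral_unique f0 algebra_simps)
qed

text \<open>
  The characteristic data of the kernel: up to sign, \<open>G\<close> is \<open>K\<^sub>D(x, x)\<close> for the parameter \<open>-f'(0)\<close>.
\<close>

lemma darboux_pair_potential:
  "darboux_pair (\<lambda>x. f' 0 / 2 + 1 / 2 * integral {0..x} q) (\<lambda>x. f' 0 / 2 - 1 / 2 * integral {0..x} qD)"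
proof (rule darboux_pairI)
  fix x assume x: "x \<in> {0..b}"
  have "((\<lambda>x. f x * (f' 0 / 2 + 1 / 2 * integral {0..x} q - (f' 0 / 2 - 1 / 2 * integral {0..x} qD)))
      has_vector_derivative f x * (1 / 2 * q x - (0 - 1 / 2 * qD x))
      + f' x * (f' 0 / 2 + 1 / 2 * integral {0..x} q - (f' 0 / 2 - 1 / 2 * integral {0..x} qD)))
      (at x within {0..b})"
    by (intro has_vector_derivative_mult[OF f_deriv[OF x]] has_vector_derivative_diff
        has_vector_derivative_const has_vector_derivative_mult_right
        integral_has_vector_derivative[OF qD_cont x])
      (rule has_vector_derivative_eq_rhs, rule has_vector_derivative_add[OF has_vector_derivative_const
          has_vector_derivative_mult_right[OF integral_has_vector_derivative[OF q_cont x]]], simp)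
  also have "f x * (1 / 2 * q x - (0 - 1 / 2 * qD x))
      + f' x * (f' 0 / 2 + 1 / 2 * integral {0..x} q - (f' 0 / 2 - 1 / 2 * integral {0..x} qD))
      = 2 * f' x * (f' 0 / 2 + 1 / 2 * integral {0..x} q)"
    unfolding integral_qD[OF x] darboux_potential_def using f_nz[OF x]
    by (simp add: field_simps power2_eq_square)
  finally show "((\<lambda>x. f x * (f' 0 / 2 + 1 / 2 * integral {0..x} q - (f' 0 / 2 - 1 / 2 * integral {0..x} qD)))
      has_vector_derivative 2 * f' x * (f' 0 / 2 + 1 / 2 * integral {0..x} q)) (at x within {0..b})" .
qed simp

text \<open>
  Differentiating in \<open>x\<close> exchanges \<open>\<phi>\<close> and \<open>\<psi>\<close> and keeps the parity, differentiating in \<open>t\<close>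
  exchanges the parity and keeps the family.  So for the two sums \<open>g\<close> and \<open>G\<close> of opposite family
  and parity the lower order terms along \<open>x = t\<close> have the same total \<open>r\<close>:
  \<open>g' = (f'/f) g + r\<close> and \<open>G' = -(f'/f) G + r\<close>, whence \<open>(f (g - G))' = 2 f' g\<close>.
\<close>

lemma darboux_pair_diagonal:
  "darboux_pair (\<lambda>x. wave_sum (phi f) ev (Suc m) x x) (\<lambda>x. wave_sum (psi f) (\<not> ev) (Suc m) x x)"
proof (rule darboux_pairI)
  fix x assume x: "x \<in> {0..b}"
  have id: "(\<lambda>y. y + 0) ` {0..b} \<subseteq> {0..b}" by auto
  note 1 = phi_sum_deriv[where c = 0 and d = 0 and \<tau> = 1 and ev = ev and m = "Suc m", OF _ id x, simplified]
  note 2 = psi_sum_deriv[where c = 0 and d = 0 and \<tau> = 1 and ev = "\<not> ev" and m = "Suc m", OF _ id x, simplified]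
  show "((\<lambda>x. f x * (wave_sum (phi f) ev (Suc m) x x - wave_sum (psi f) (\<not> ev) (Suc m) x x))
      has_vector_derivative 2 * f' x * wave_sum (phi f) ev (Suc m) x x) (at x within {0..b})"
    by (rule has_vector_derivative_eq_rhs,
        rule has_vector_derivative_mult[OF f_deriv[OF x] has_vector_derivative_diff[OF 1 2]])
      (use f_nz[OF x] in \<open>simp add: field_simps\<close>)
qed (simp add: wave_sum_at_origin phi_psi_at_0)

section \<open>The approximation error on the characteristics\<close>

lemma wave_sum_filter:
  "wave_sum \<xi> ev m x t =
     (\<Sum>k | even k = ev \<and> k \<le> m. of_nat (m choose k) * \<xi> (m - k) x * of_real t ^ k)"
proof -
  have "{k. even k = ev \<and> k \<le> m} = {k \<in> {..m}. even k = ev}" by auto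
  then show ?thesis by (simp only: wave_sum_def sum.inter_filter[OF finite_atMost])
qed

lemma c_fun_eq_wave_sum: "c_fun f m x = wave_sum (phi f) True m x x"
proof (cases "m = 0")
  case True
  then show ?thesis by (simp add: c_fun_def wave_sum_def phi_def atMost_0)
next
  case False
  then show ?thesis by (simp add: c_fun_def wave_sum_filter mult_ac)
qed

lemma s_fun_eq_wave_sum: "s_fun f m x = wave_sum (phi f) False m x x"
  by (simp add: s_fun_def wave_sum_filter mult_ac)

lemma wave_sum_psi_0: "wave_sum (psi f) True 0 x t = 1 / f x"
  by (simp add: wave_sum_def psi_def atMost_0)

lemma wave_poly_eq_wave_sum:
  "wave_poly f 0 x t = wave_sum (psi f) True 0 x t"
  "1 \<le> n \<Longrightarrow> wave_poly f (2 * n - 1) x t = wave_sum (psi f) True n x t"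
  "1 \<le> n \<Longrightarrow> wave_poly f (2 * n) x t = wave_sum (psi f) False n x t"
proof -
  show "wave_poly f 0 x t = wave_sum (psi f) True 0 x t"
    by (simp add: wave_poly_def wave_sum_def atMost_0)
  assume n: "1 \<le> n"
  then have "odd (2 * n - 1)" "(2 * n - 1 + 1) div 2 = n" by auto
  then show "wave_poly f (2 * n - 1) x t = wave_sum (psi f) True n x t"
    by (auto simp: wave_poly_def wave_sum_filter Let_def)
  show "wave_poly f (2 * n) x t = wave_sum (psi f) False n x t"
    using n by (simp add: wave_poly_def wave_sum_filter Let_def)
qed

lemma approx_kernel_eq_wave_sums:
  "approx_kernel f N a \<beta> x t = - a 0 * wave_sum (psi f) True 0 x t
     - (\<Sum>n=1..N. \<beta> n * wave_sum (psi f) True n x t)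
     - (\<Sum>n=1..N. a n * wave_sum (psi f) False n x t)"
  unfolding approx_kernel_def wave_poly_eq_wave_sum(1)
  by (intro arg_cong2[where f = "(-)"] sum.cong refl)
    (simp_all only: wave_poly_eq_wave_sum atLeastAtMost_iff)

definition approx_dv ::
    "nat \<Rightarrow> (nat \<Rightarrow> complex) \<Rightarrow> (nat \<Rightarrow> complex) \<Rightarrow> real \<Rightarrow> real \<Rightarrow> complex" where
  "approx_dv N a \<beta> u v = - a 0 * psi_sum_dv True 0 u v
     - (\<Sum>n=1..N. \<beta> n * psi_sum_dv True n u v) - (\<Sum>n=1..N. a n * psi_sum_dv False n u v)"

lemma approx_kernel_deriv_v:
  assumes "(u, v) \<in> goursat_triangle b"
  shows "((\<lambda>y. approx_kernel f N a \<beta> (u + y) (u - y)) has_vector_derivative approx_dv N a \<beta> u v)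
      (at v within {0..b - u})"
  unfolding approx_kernel_eq_wave_sums approx_dv_def
  by (intro has_vector_derivative_diff has_vector_derivative_mult_right has_vector_derivative_sum
      psi_sum_deriv_v assms)

lemma approx_kernel_deriv_uv:
  assumes "(u, v) \<in> goursat_triangle b"
  shows "((\<lambda>y. approx_dv N a \<beta> y v) has_vector_derivative
      qD (u + v) * approx_kernel f N a \<beta> (u + v) (u - v)) (at u within {0..b - v})"
proof -
  have "((\<lambda>y. approx_dv N a \<beta> y v) has_vector_derivative
      - a 0 * (qD (u + v) * wave_sum (psi f) True 0 (u + v) (u - v))
      - (\<Sum>n=1..N. \<beta> n * (qD (u + v) * wave_sum (psi f) True n (u + v) (u - v)))
      - (\<Sum>n=1..N. a n * (qD (u + v) * wave_sum (psi f) False n (u + v) (u - v))))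
      (at u within {0..b - v})"
    unfolding approx_dv_def
    by (intro has_vector_derivative_diff has_vector_derivative_mult_right has_vector_derivative_sum
        psi_sum_deriv_uv assms)
  then show ?thesis
    by (simp add: approx_kernel_eq_wave_sums right_diff_distrib sum_distrib_left mult.left_commute)
qed

lemma approx_kernel_cont:
  "continuous_on (goursat_triangle b) (\<lambda>(u, v). approx_kernel f N a \<beta> (u + v) (u - v))"
  using psi_sum_cont unfolding approx_kernel_eq_wave_sums case_prod_unfold
  by (intro continuous_intros) auto

definition c_error :: "nat \<Rightarrow> (nat \<Rightarrow> complex) \<Rightarrow> real \<Rightarrow> complex" where
  "c_error N a x = f' 0 / 2 + 1 / 4 * integral {0..x} q - (\<Sum>n=0..N. a n * c_fun f n x)"

definition s_error :: "nat \<Rightarrow> (nat \<Rightarrow> complex) \<Rightarrow> real \<Rightarrow> complex" where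
  "s_error N \<beta> x = 1 / 4 * integral {0..x} q - (\<Sum>n=1..N. \<beta> n * s_fun f n x)"

lemma darboux_pair_c_sum:
  "darboux_pair (\<lambda>x. \<Sum>n=0..N. a n * c_fun f n x)
     (\<lambda>x. a 0 / f x + (\<Sum>n=1..N. a n * wave_sum (psi f) False n x x))"
proof -
  have c0: "darboux_pair (\<lambda>x. a 0 * c_fun f 0 x) (\<lambda>x. a 0 * (1 / f x))"
    using darboux_pair_scale[OF darboux_pair_f] by (simp add: c_fun_def)
  have "darboux_pair (\<lambda>x. \<Sum>n=1..N. a n * c_fun f n x)
      (\<lambda>x. \<Sum>n=1..N. a n * wave_sum (psi f) False n x x)"
  proof (intro darboux_pair_sum darboux_pair_scale)
    fix n assume "n \<in> {1..N}"
    then show "darboux_pair (c_fun f n) (\<lambda>x. wave_sum (psi f) False n x x)"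
      using darboux_pair_diagonal[of True "n - 1"] by (simp add: c_fun_eq_wave_sum[abs_def])
  qed
  from darboux_pair_add[OF c0 this] show ?thesis
    by (simp add: sum.atLeast_Suc_atMost)
qed

lemma darboux_pair_s_sum:
  "darboux_pair (\<lambda>x. \<Sum>n=1..N. \<beta> n * s_fun f n x)
     (\<lambda>x. \<Sum>n=1..N. \<beta> n * wave_sum (psi f) True n x x)"
proof (intro darboux_pair_sum darboux_pair_scale)
  fix n assume "n \<in> {1..N}"
  then show "darboux_pair (s_fun f n) (\<lambda>x. wave_sum (psi f) True n x x)"
    using darboux_pair_diagonal[of False "n - 1"] by (simp add: s_fun_eq_wave_sum[abs_def])
qed

lemma darboux_pair_error_sum:
  "darboux_pair (\<lambda>x. c_error N a x + s_error N \<beta> x)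
     (\<lambda>x. approx_kernel f N a \<beta> x x - (- f' 0 / 2 + 1 / 2 * integral {0..x} qD))"
proof -
  have g: "f' 0 / 2 + 1 / 2 * integral {0..x} q - (\<Sum>n=0..N. a n * c_fun f n x)
      - (\<Sum>n=1..N. \<beta> n * s_fun f n x) = c_error N a x + s_error N \<beta> x" for x
    by (simp add: c_error_def s_error_def)
  have G: "f' 0 / 2 - 1 / 2 * integral {0..x} qD
      - (a 0 / f x + (\<Sum>n=1..N. a n * wave_sum (psi f) False n x x))
      - (\<Sum>n=1..N. \<beta> n * wave_sum (psi f) True n x x)
      = approx_kernel f N a \<beta> x x - (- f' 0 / 2 + 1 / 2 * integral {0..x} qD)" for x
    by (simp add: approx_kernel_eq_wave_sums wave_sum_psi_0)
  show ?thesis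
    using darboux_pair_diff[OF darboux_pair_diff[OF darboux_pair_potential
          darboux_pair_c_sum[of a N]] darboux_pair_s_sum[of \<beta> N]]
    unfolding g G .
qed

text \<open>
  On \<open>t = -x\<close> the sums odd in \<open>t\<close> change sign but the term \<open>a\<^sub>0 v\<^sub>0\<close> does not; this leaves the
  multiple of \<open>f'(0) / 2 - a\<^sub>0\<close>, which is the value of the first error at \<open>0\<close>.
\<close>

lemma darboux_pair_error_diff:
  "darboux_pair (\<lambda>x. s_error N \<beta> x - c_error N a x)
     (\<lambda>x. approx_kernel f N a \<beta> x (- x) - (- f' 0 / 2) - 2 * c_error N a 0 / f x)"
proof -
  have "c_fun f n 0 = 0" if "n \<noteq> 0" for n
    using that phi_psi_at_0(1)[of "n - 1"] by (simp add: c_fun_eq_wave_sum wave_sum_at_origin)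
  then have "(\<Sum>n=1..N. a n * c_fun f n 0) = 0"
    by (intro sum.neutral) auto
  then have e0: "c_error N a 0 = f' 0 / 2 - a 0"
    by (simp add: c_error_def sum.atLeast_Suc_atMost[of 0] c_fun_def[of f 0] f0)
  have g: "- (f' 0 / 2) * 1 + (\<Sum>n=0..N. a n * c_fun f n x)
      - (\<Sum>n=1..N. \<beta> n * s_fun f n x) = s_error N \<beta> x - c_error N a x" for x
    by (simp add: c_error_def s_error_def)
  have G: "- (f' 0 / 2) * (2 / f x - 1)
      + (a 0 / f x + (\<Sum>n=1..N. a n * wave_sum (psi f) False n x x))
      - (\<Sum>n=1..N. \<beta> n * wave_sum (psi f) True n x x)
      = approx_kernel f N a \<beta> x (- x) - (- f' 0 / 2) - 2 * c_error N a 0 / f x" for x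
    unfolding e0 approx_kernel_eq_wave_sums wave_sum_psi_0 wave_sum_minus
    by (simp add: sum_negf algebra_simps diff_divide_distrib)
  show ?thesis
    using darboux_pair_diff[OF darboux_pair_add[OF darboux_pair_scale[OF darboux_pair_1,
            of "- (f' 0 / 2)"] darboux_pair_c_sum[of a N]] darboux_pair_s_sum[of \<beta> N]]
    unfolding g G .
qed

end

section \<open>The error estimate\<close>

lemma compact_goursat_triangle: "compact (goursat_triangle b)"
proof -
  have "goursat_triangle b = ({0..b} \<times> {0..b}) \<inter> {p. fst p + snd p \<le> b}"
    by (auto simp: goursat_triangle_def)
  moreover have "closed {p :: real \<times> real. fst p + snd p \<le> b}"
    by (intro closed_Collect_le continuous_intros)
  ultimately show ?thesis
    by (simp add: compact_Int_closed compact_Times)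
qed

lemma norm_le_SUP_interval:
  fixes g :: "real \<Rightarrow> complex"
  assumes "continuous_on {a..b} g" and "x \<in> {a..b}"
  shows "cmod (g x) \<le> (SUP x\<in>{a..b}. cmod (g x))"
proof (rule cSUP_upper[OF assms(2)])
  have "compact ((\<lambda>x. cmod (g x)) ` {a..b})"
    by (intro compact_continuous_image continuous_on_norm assms(1) compact_Icc)
  then show "bdd_above ((\<lambda>x. cmod (g x)) ` {a..b})"
    by (intro bounded_imp_bdd_above compact_imp_bounded)
qed

theorem theorem8p2:
  fixes b :: real
    and q f f' qD :: "real \<Rightarrow> complex"
    and h :: complex
    and K :: "real \<Rightarrow> real \<Rightarrow> complex"
    and N :: nat
    and a \<beta> :: "nat \<Rightarrow> complex"
    and \<epsilon>1 \<epsilon>2 M M1 M2 C :: real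
  assumes "0 < b"
    and "continuous_on {0..b} q"
    and "\<forall>x\<in>{0..b}. (f has_vector_derivative f' x) (at x within {0..b})"
    and "\<forall>x\<in>{0..b}. (f' has_vector_derivative q x * f x) (at x within {0..b})"
    and "\<forall>x\<in>{0..b}. f x \<noteq> 0"
    and "f 0 = 1"
    and "h = f' 0"
    and "qD = darboux_potential q f f'"
    and "is_transmutation_kernel b qD (- h) K"
    and "\<forall>x\<in>{0..b}. cmod (h / 2 + 1 / 4 * integral {0..x} q
                          - (\<Sum>n=0..N. a n * c_fun f n x)) < \<epsilon>1"
    and "\<forall>x\<in>{0..b}. cmod (1 / 4 * integral {0..x} q
                          - (\<Sum>n=1..N. \<beta> n * s_fun f n x)) < \<epsilon>2"
    and "M = (SUP x\<in>{0..b}. cmod (qD x))"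
    and "M1 = (SUP x\<in>{0..b}. cmod (1 / f x))"
    and "M2 = (SUP x\<in>{0..b}. cmod (f' x))"
    and "C = 3 * bessel_I0 (b * sqrt M)"
  shows "\<forall>(x, t) \<in> region_R1 b.
           cmod (K x t - approx_kernel f N a \<beta> x t)
             \<le> C * (\<epsilon>1 * M1 + (\<epsilon>1 + \<epsilon>2) * (2 * M1 * M2 * b + M1 + 1))"
proof -
  interpret nonvanishing_solution b q f f'
    by unfold_locales (use assms in auto)
  have qD: "qD = darboux_potential q f f'" by fact
  have zero: "0 \<in> {0..b}" using b_pos by simp

  have M: "cmod (qD x) \<le> M" if "x \<in> {0..b}" for x
    unfolding \<open>M = _\<close> qD using qD_cont that by (rule norm_le_SUP_interval)
  have "continuous_on {0..b} (\<lambda>x. 1 / f x)"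
    using f_nz by (auto intro!: continuous_intros f_cont)
  then have M1: "cmod (1 / f x) \<le> M1" if "x \<in> {0..b}" for x
    unfolding \<open>M1 = _\<close> using that by (rule norm_le_SUP_interval)
  have M2: "cmod (f' x) \<le> M2" if "x \<in> {0..b}" for x
    unfolding \<open>M2 = _\<close> using f'_cont that by (rule norm_le_SUP_interval)
  have M1_nn: "0 \<le> M1" and M2_nn: "0 \<le> M2"
    using M1[OF zero] M2[OF zero] norm_ge_zero order_trans by blast+

  have e1: "cmod (c_error N a x) \<le> \<epsilon>1" if "x \<in> {0..b}" for x
    using assms(7,10) that by (auto simp: c_error_def intro: less_imp_le)
  have e2: "cmod (s_error N \<beta> x) \<le> \<epsilon>2" if "x \<in> {0..b}" for x
    using assms(11) that by (auto simp: s_error_def intro: less_imp_le)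
  have eps_nn: "0 \<le> \<epsilon>1" "0 \<le> \<epsilon>2"
    using e1[OF zero] e2[OF zero] norm_ge_zero order_trans by blast+

  obtain H where H: "goursat_solution b qD (- h) H"
    and KH: "\<And>x t. (x, t) \<in> region_R1 b \<Longrightarrow> K x t = H ((x + t) / 2) ((x - t) / 2)"
    using assms(9) unfolding is_transmutation_kernel_def by auto
  obtain Hv where
    Hv: "\<And>u v. (u, v) \<in> goursat_triangle b \<Longrightarrow>
        ((\<lambda>y. H u y) has_vector_derivative Hv u v) (at v within {0..b - u})"
    and Huv: "\<And>u v. (u, v) \<in> goursat_triangle b \<Longrightarrow>
        ((\<lambda>y. Hv y v) has_vector_derivative qD (u + v) * H u v) (at u within {0..b - v})"
    using H unfolding goursat_solution_def by fast
  have H_cont: "continuous_on (goursat_triangle b) (\<lambda>(u, v). H u v)"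
    and Hu0: "\<And>u. u \<in> {0..b} \<Longrightarrow> H u 0 = - f' 0 / 2 + 1 / 2 * integral {0..u} qD"
    and H0v: "\<And>v. v \<in> {0..b} \<Longrightarrow> H 0 v = - f' 0 / 2"
    using H assms(7) unfolding goursat_solution_def by auto

  define A where "A = (\<lambda>u v. approx_kernel f N a \<beta> (u + v) (u - v))"
  define W where "W = (\<lambda>u v. H u v - A u v)"
  define Wv where "Wv = (\<lambda>u v. Hv u v - approx_dv N a \<beta> u v)"
  define D where "D = (\<epsilon>1 + \<epsilon>2) * (1 + 2 * M1 * M2 * b)"

  have data_v0: "cmod (W u 0) \<le> D" if u: "u \<in> {0..b}" for u
  proof -
    have "cmod (c_error N a s + s_error N \<beta> s) \<le> \<epsilon>1 + \<epsilon>2" if "s \<in> {0..b}" for s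
      using norm_triangle_mono[OF e1[OF that] e2[OF that]] .
    from darboux_pair_bound[OF darboux_pair_error_sum u this M1[OF u] M2]
    have "cmod (A u 0 - H u 0) \<le> D"
      using Hu0[OF u] by (simp add: A_def D_def qD)
    then show ?thesis by (simp add: W_def norm_minus_commute)
  qed
  have data_u0: "cmod (W 0 v) \<le> D + 2 * \<epsilon>1 * M1" if v: "v \<in> {0..b}" for v
  proof -
    have "cmod (s_error N \<beta> s - c_error N a s) \<le> \<epsilon>1 + \<epsilon>2" if "s \<in> {0..b}" for s
      using norm_triangle_ineq4[of "s_error N \<beta> s" "c_error N a s"] e1[OF that] e2[OF that]
      by linarith
    from darboux_pair_bound[OF darboux_pair_error_diff v this M1[OF v] M2]
    have 1: "cmod (A 0 v - H 0 v - 2 * c_error N a 0 / f v) \<le> D"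
      using H0v[OF v] by (simp add: A_def D_def)
    have "cmod (2 * c_error N a 0 / f v) = 2 * (cmod (c_error N a 0) * cmod (1 / f v))"
      by (simp add: norm_mult norm_divide)
    also have "\<dots> \<le> 2 * (\<epsilon>1 * M1)"
      using e1[OF zero] M1[OF v] eps_nn by (intro mult_left_mono mult_mono) auto
    finally have "cmod (A 0 v - H 0 v) \<le> D + 2 * \<epsilon>1 * M1"
      using 1 norm_triangle_sub[of "A 0 v - H 0 v" "2 * c_error N a 0 / f v"] by simp
    then show ?thesis by (simp add: W_def norm_minus_commute)
  qed

  have "continuous_on (goursat_triangle b) (\<lambda>p. W (fst p) (snd p))"
    using continuous_on_diff[OF H_cont approx_kernel_cont[of N a \<beta>]]
    by (simp add: W_def A_def case_prod_unfold)
  then have "bounded ((\<lambda>p. W (fst p) (snd p)) ` goursat_triangle b)"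
    by (intro compact_imp_bounded compact_continuous_image compact_goursat_triangle)
  then obtain S where S: "\<And>u v. (u, v) \<in> goursat_triangle b \<Longrightarrow> cmod (W u v) \<le> S"
    unfolding bounded_iff by fastforce

  (* The three boundary terms W(u, 0), W(0, v), W(0, 0) are estimated separately; this is the
     origin of the factor 3 in C. *)
  interpret goursat_bound b qD W Wv M "3 * D + 2 * \<epsilon>1 * M1"
  proof
    fix u v assume uv: "(u, v) \<in> goursat_triangle b"
    show "((\<lambda>y. W u y) has_vector_derivative Wv u v) (at v within {0..b - u})"
      unfolding W_def Wv_def A_def
      by (intro has_vector_derivative_diff Hv approx_kernel_deriv_v uv)
    show "((\<lambda>y. Wv y v) has_vector_derivative qD (u + v) * W u v) (at u within {0..b - v})"
      using has_vector_derivative_diff[OF Huv[OF uv] approx_kernel_deriv_uv[OF uv, of N a \<beta>]]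
      by (simp add: W_def Wv_def A_def qD right_diff_distrib)
    have "u \<in> {0..b}" "v \<in> {0..b}" using uv by (auto simp: goursat_triangle_def)
    then have "cmod (W u 0) + cmod (W 0 v) + cmod (W 0 0) \<le> D + (D + 2 * \<epsilon>1 * M1) + D"
      by (intro add_mono data_v0 data_u0 zero)
    moreover have "cmod (W u 0 + W 0 v - W 0 0) \<le> cmod (W u 0) + cmod (W 0 v) + cmod (W 0 0)"
      using norm_triangle_ineq4[of "W u 0 + W 0 v" "W 0 0"] norm_triangle_ineq[of "W u 0" "W 0 v"]
      by linarith
    ultimately show "cmod (W u 0 + W 0 v - W 0 0) \<le> 3 * D + 2 * \<epsilon>1 * M1" by linarith
  qed (use M in auto)

  let ?R = "\<epsilon>1 * M1 + (\<epsilon>1 + \<epsilon>2) * (2 * M1 * M2 * b + M1 + 1)"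
  have "0 \<le> \<epsilon>1 * M1" "0 \<le> (\<epsilon>1 + \<epsilon>2) * M1" using M1_nn eps_nn by simp_all
  then have const: "3 * D + 2 * \<epsilon>1 * M1 \<le> 3 * ?R"
    by (simp add: D_def algebra_simps)
  show ?thesis
  proof (intro ballI, clarify)
    fix x t assume xt: "(x, t) \<in> region_R1 b"
    let ?u = "(x + t) / 2" and ?v = "(x - t) / 2"
    have uv: "(?u, ?v) \<in> goursat_triangle b"
      using xt by (auto simp: region_R1_def goursat_triangle_def field_simps)
    have sum: "?u + ?v = x" and diff: "?u - ?v = t" by (simp_all add: field_simps)
    have "cmod (K x t - approx_kernel f N a \<beta> x t) = cmod (W ?u ?v)"
      unfolding W_def A_def sum diff KH[OF xt] ..
    also have "\<dots> \<le> (3 * D + 2 * \<epsilon>1 * M1) * bessel_I0 (b * sqrt M)"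
      by (rule goursat_bessel_bound[OF S uv])
    also have "\<dots> \<le> 3 * ?R * bessel_I0 (b * sqrt M)"
      by (rule mult_right_mono[OF const bessel_I0_nonneg])
    also have "\<dots> = C * ?R" unfolding \<open>C = _\<close> by simp
    finally show "cmod (K x t - approx_kernel f N a \<beta> x t) \<le> C * ?R" .
  qed
qed

end
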